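(* Let $\Delta$ be a type environment of $\mathbf{F}_2^\mu$, $T$ a type and $k$ a kind with $\Delta \vdash T : k$. If $T \to_o T'$, then $\mathrm{FV}(T) = \mathrm{FV}(T')$ and $\Delta \vdash T' : k$.
   Context: Types of $\mathbf{F}_2^\mu$: $T ::= F \mid x \mid \lambda x.T \mid \forall x{:}K.T \mid T\,T' \mid T \Rightarrow T'$, where $F$ ranges over type constants and $x$ over type variables. Term kinds $K ::= * \mid * \Rightarrow K$; kinds $k ::= o \mid K$. Type environments $\Delta ::= \cdot \mid x:K,\Delta \mid F:K,\Delta$. The kinding judgement $\Delta \vdash T : k$ is defined by: (i) $\Delta \vdash x : K$ (resp. $\Delta\vdash F:K$) if $x:K\in\Delta$ (resp. $F:K\in\Delta$); (ii) if $\Delta\vdash T_1 : *$ and $\Delta \vdash T_2 : *\Rightarrow K$ then $\Delta\vdash T_2\,T_1 : K$; (iii) if $\Delta, x:* \vdash T : K$ and $x \in \mathrm{FV}(T)$ then $\Delta \vdash \lambda x.T : * \Rightarrow K$; (iv) if $\Delta, x:K \vdash T : o$ or $\Delta, x:K\vdash T:*$ then $\Delta \vdash \forall x{:}K.T : o$; (v) if each of $T, T'$ has kind $o$ or kind $*$ under $\Delta$ then $\Delta \vdash T \Rightarrow T' : o$. The relation $\to_o$ is the compatible closure of type-level beta reduction $(\lambda x.T)\,T' \to_o [T'/x]T$. $\mathrm{FV}(T)$ is the set of free type variables of $T$. *)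

theory Defs
  imports Main
begin

type_synonym tyvar = string
type_synonym tycon = string

datatype tkind = Star | Arr tkind

datatype kind = Prop | Term tkind

section \<open>Types up to renaming of bound variables\<close>

text \<open>
  Types are identified up to renaming of bound variables. The identification is realised by a
  locally nameless representation: in a preterm, free variables carry names and bound variables
  are de Bruijn indices, and a type is a preterm without dangling indices. The index
  representation is internal; everything after this section is stated with the named constructors
  \<open>TLam x T\<close> and \<open>TAll x K T\<close>, which bind \<open>x\<close> in \<open>T\<close>.
\<close>

datatype pre =
    PCon tycon
  | PBound nat
  | PFree tyvar
  | PLam pre
  | PAll tkind pre
  | PApp pre pre
  | PImp pre pre

text \<open>All indices of the preterm are bound once it is placed under \<open>n\<close> further binders.\<close>

primrec closed_at :: "nat \<Rightarrow> pre \<Rightarrow> bool" where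
  "closed_at n (PCon F) \<longleftrightarrow> True"
| "closed_at n (PBound i) \<longleftrightarrow> i < n"
| "closed_at n (PFree x) \<longleftrightarrow> True"
| "closed_at n (PLam t) \<longleftrightarrow> closed_at (Suc n) t"
| "closed_at n (PAll K t) \<longleftrightarrow> closed_at (Suc n) t"
| "closed_at n (PApp t u) \<longleftrightarrow> closed_at n t \<and> closed_at n u"
| "closed_at n (PImp t u) \<longleftrightarrow> closed_at n t \<and> closed_at n u"

text \<open>Turns the free occurrences of \<open>x\<close> into references to the binder \<open>n\<close> levels up.\<close>

primrec bind_at :: "nat \<Rightarrow> tyvar \<Rightarrow> pre \<Rightarrow> pre" where
  "bind_at n x (PCon F) = PCon F"
| "bind_at n x (PBound i) = PBound i"
| "bind_at n x (PFree y) = (if y = x then PBound n else PFree y)"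
| "bind_at n x (PLam t) = PLam (bind_at (Suc n) x t)"
| "bind_at n x (PAll K t) = PAll K (bind_at (Suc n) x t)"
| "bind_at n x (PApp t u) = PApp (bind_at n x t) (bind_at n x u)"
| "bind_at n x (PImp t u) = PImp (bind_at n x t) (bind_at n x u)"

primrec pre_FV :: "pre \<Rightarrow> tyvar set" where
  "pre_FV (PCon F) = {}"
| "pre_FV (PBound i) = {}"
| "pre_FV (PFree x) = {x}"
| "pre_FV (PLam t) = pre_FV t"
| "pre_FV (PAll K t) = pre_FV t"
| "pre_FV (PApp t u) = pre_FV t \<union> pre_FV u"
| "pre_FV (PImp t u) = pre_FV t \<union> pre_FV u"

text \<open>
  When \<open>s\<close> has no dangling indices, this cannot capture: names are never bound in a preterm.
\<close>

primrec pre_subst :: "pre \<Rightarrow> tyvar \<Rightarrow> pre \<Rightarrow> pre" where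
  "pre_subst s x (PCon F) = PCon F"
| "pre_subst s x (PBound i) = PBound i"
| "pre_subst s x (PFree y) = (if y = x then s else PFree y)"
| "pre_subst s x (PLam t) = PLam (pre_subst s x t)"
| "pre_subst s x (PAll K t) = PAll K (pre_subst s x t)"
| "pre_subst s x (PApp t u) = PApp (pre_subst s x t) (pre_subst s x u)"
| "pre_subst s x (PImp t u) = PImp (pre_subst s x t) (pre_subst s x u)"

lemma closed_at_mono: "closed_at m t \<Longrightarrow> m \<le> n \<Longrightarrow> closed_at n t"
  by (induction t arbitrary: m n) force+

lemma closed_at_bind_at: "closed_at n t \<Longrightarrow> closed_at (Suc n) (bind_at n x t)"
  by (induction t arbitrary: n) auto

lemma closed_at_pre_subst: "closed_at n t \<Longrightarrow> closed_at 0 s \<Longrightarrow> closed_at n (pre_subst s x t)"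
  by (induction t arbitrary: n) (auto intro: closed_at_mono)

typedef ty = "{t. closed_at 0 t}"
  by (rule exI[of _ "PCon []"]) simp

setup_lifting type_definition_ty

lift_definition TCon :: "tycon \<Rightarrow> ty" is PCon by simp
lift_definition TVar :: "tyvar \<Rightarrow> ty" is PFree by simp
lift_definition TLam :: "tyvar \<Rightarrow> ty \<Rightarrow> ty" is "\<lambda>x t. PLam (bind_at 0 x t)"
  by (simp add: closed_at_bind_at)
lift_definition TAll :: "tyvar \<Rightarrow> tkind \<Rightarrow> ty \<Rightarrow> ty" is "\<lambda>x K t. PAll K (bind_at 0 x t)"
  by (simp add: closed_at_bind_at)
lift_definition TApp :: "ty \<Rightarrow> ty \<Rightarrow> ty" is PApp by simp
lift_definition TImp :: "ty \<Rightarrow> ty \<Rightarrow> ty" is PImp by simp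

lift_definition FV :: "ty \<Rightarrow> tyvar set" is pre_FV .

text \<open>\<open>subst U x T\<close> is the capture-avoiding substitution \<open>[U/x]T\<close>.\<close>

lift_definition subst :: "ty \<Rightarrow> tyvar \<Rightarrow> ty \<Rightarrow> ty" is pre_subst
  by (simp add: closed_at_pre_subst)

subsection \<open>Adequacy of the representation\<close>

lemma pre_FV_bind_at: "pre_FV (bind_at n x t) = pre_FV t - {x}"
  by (induction t arbitrary: n) auto

lemma FV_simps [simp]:
  "FV (TCon F) = {}"
  "FV (TVar x) = {x}"
  "FV (TLam x T) = FV T - {x}"
  "FV (TAll x K T) = FV T - {x}"
  "FV (TApp T U) = FV T \<union> FV U"
  "FV (TImp T U) = FV T \<union> FV U"
  by (transfer; simp add: pre_FV_bind_at)+

lemma bind_at_fresh: "x \<notin> pre_FV t \<Longrightarrow> bind_at n x t = t"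
  by (induction t arbitrary: n) auto

lemma pre_subst_bind_at:
  "y \<noteq> x \<Longrightarrow> y \<notin> pre_FV s \<Longrightarrow> pre_subst s x (bind_at n y t) = bind_at n y (pre_subst s x t)"
  by (induction t arbitrary: n) (auto simp: bind_at_fresh)

lemma subst_simps:
  "subst U x (TCon F) = TCon F"
  "subst U x (TVar y) = (if y = x then U else TVar y)"
  "y \<noteq> x \<Longrightarrow> y \<notin> FV U \<Longrightarrow> subst U x (TLam y T) = TLam y (subst U x T)"
  "y \<noteq> x \<Longrightarrow> y \<notin> FV U \<Longrightarrow> subst U x (TAll y K T) = TAll y K (subst U x T)"
  "subst U x (TApp T T') = TApp (subst U x T) (subst U x T')"
  "subst U x (TImp T T') = TImp (subst U x T) (subst U x T')"
  by (transfer; simp add: pre_subst_bind_at)+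

lemma bind_at_rename:
  "y \<notin> pre_FV t \<Longrightarrow> bind_at n y (pre_subst (PFree y) x t) = bind_at n x t"
  by (induction t arbitrary: n) auto

lemma bind_at_inject: "closed_at n t \<Longrightarrow> closed_at n u \<Longrightarrow> bind_at n x t = bind_at n x u \<longleftrightarrow> t = u"
proof (induction t arbitrary: n u)
  case (PCon F)
  then show ?case by (cases u) auto
next
  case (PBound i)
  then show ?case by (cases u) auto
next
  case (PFree y)
  then show ?case by (cases u) auto
next
  case (PLam t)
  then show ?case by (cases u) auto
next
  case (PAll K t)
  then show ?case by (cases u) auto
next
  case (PApp t1 t2)
  then show ?case by (cases u) auto
next
  case (PImp t1 t2)
  then show ?case by (cases u) auto
qed

lemma bind_at_eq_iff:
  assumes "closed_at n t" "closed_at n u"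
  shows "bind_at n x t = bind_at n y u \<longleftrightarrow>
    (x = y \<and> t = u) \<or> (x \<noteq> y \<and> y \<notin> pre_FV t \<and> u = pre_subst (PFree y) x t)"
proof (cases "x = y")
  case True
  with assms show ?thesis by (simp add: bind_at_inject)
next
  case False
  have cl: "closed_at n (pre_subst (PFree y) x t)"
    using assms(1) by (simp add: closed_at_pre_subst)
  show ?thesis
  proof
    assume eq: "bind_at n x t = bind_at n y u"
    then have "pre_FV t - {x} = pre_FV u - {y}"
      by (metis pre_FV_bind_at)
    with False have y: "y \<notin> pre_FV t" by blast
    with eq have "bind_at n y (pre_subst (PFree y) x t) = bind_at n y u"
      by (simp add: bind_at_rename)
    with cl assms(2) y False
    show "(x = y \<and> t = u) \<or> (x \<noteq> y \<and> y \<notin> pre_FV t \<and> u = pre_subst (PFree y) x t)"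
      by (simp add: bind_at_inject)
  next
    assume "(x = y \<and> t = u) \<or> (x \<noteq> y \<and> y \<notin> pre_FV t \<and> u = pre_subst (PFree y) x t)"
    then show "bind_at n x t = bind_at n y u"
      by (auto simp: bind_at_rename)
  qed
qed

lemma TLam_eq_iff:
  "TLam x T = TLam y U \<longleftrightarrow>
    (x = y \<and> T = U) \<or> (x \<noteq> y \<and> y \<notin> FV T \<and> U = subst (TVar y) x T)"
  by transfer (simp add: bind_at_eq_iff)

lemma TAll_eq_iff:
  "TAll x K T = TAll y L U \<longleftrightarrow>
    K = L \<and> ((x = y \<and> T = U) \<or> (x \<noteq> y \<and> y \<notin> FV T \<and> U = subst (TVar y) x T))"
  by transfer (auto simp: bind_at_eq_iff)

lemma bind_at_surj:
  assumes "closed_at (Suc n) t" "x \<notin> pre_FV t"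
  shows "\<exists>u. closed_at n u \<and> bind_at n x u = t"
  using assms
proof (induction t arbitrary: n)
  case (PCon F)
  then show ?case by (intro exI[of _ "PCon F"]) simp
next
  case (PBound i)
  then show ?case
    by (intro exI[of _ "if i = n then PFree x else PBound i"]) auto
next
  case (PFree y)
  then show ?case by (intro exI[of _ "PFree y"]) simp
next
  case (PLam t)
  then obtain u where "closed_at (Suc n) u" "bind_at (Suc n) x u = t" by fastforce
  then show ?case by (intro exI[of _ "PLam u"]) simp
next
  case (PAll K t)
  then obtain u where "closed_at (Suc n) u" "bind_at (Suc n) x u = t" by fastforce
  then show ?case by (intro exI[of _ "PAll K u"]) simp
next
  case (PApp t1 t2)
  then obtain u1 u2 where "closed_at n u1" "bind_at n x u1 = t1" "closed_at n u2" "bind_at n x u2 = t2"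
    by fastforce
  then show ?case by (intro exI[of _ "PApp u1 u2"]) simp
next
  case (PImp t1 t2)
  then obtain u1 u2 where "closed_at n u1" "bind_at n x u1 = t1" "closed_at n u2" "bind_at n x u2 = t2"
    by fastforce
  then show ?case by (intro exI[of _ "PImp u1 u2"]) simp
qed

lemma finite_pre_FV: "finite (pre_FV t)"
  by (induction t) auto

lemma finite_FV: "finite (FV T)"
  by transfer (rule finite_pre_FV)

text \<open>Every type is built by the named constructors, with bound names avoiding any finite set.\<close>

lemma ty_exhaust:
  assumes "finite (A :: tyvar set)"
  obtains (TCon) F where "T = TCon F"
  | (TVar) x where "T = TVar x"
  | (TLam) x U where "x \<notin> A" "T = TLam x U"
  | (TAll) x K U where "x \<notin> A" "T = TAll x K U"
  | (TApp) U V where "T = TApp U V"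
  | (TImp) U V where "T = TImp U V"
proof -
  have "finite (A \<union> FV T)" using assms by (simp add: finite_FV)
  then obtain x :: tyvar where x: "x \<notin> A" "x \<notin> FV T"
    by (metis UnI1 UnI2 ex_new_if_finite infinite_UNIV_listI)
  have "(\<exists>F. T = TCon F) \<or> (\<exists>x. T = TVar x) \<or> (\<exists>U. T = TLam x U) \<or> (\<exists>K U. T = TAll x K U) \<or>
        (\<exists>U V. T = TApp U V) \<or> (\<exists>U V. T = TImp U V)"
    using x(2)
  proof (transfer fixing: x, goal_cases)
    case (1 t)
    show ?case
    proof (cases t)
      case (PLam s)
      with 1 bind_at_surj[of 0 s x] show ?thesis by fastforce
    next
      case (PAll K s)
      with 1 bind_at_surj[of 0 s x] show ?thesis by fastforce
    qed (use 1 in auto)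
  qed
  with x(1) that show thesis by blast
qed

section \<open>Kinding and reduction\<close>

datatype name = Var tyvar | Con tycon

type_synonym env = "(name \<times> tkind) list"

text \<open>
  As usual, an environment is only extended by a variable it does not declare. Since types are
  identified up to renaming of bound variables, this does not restrict which types under a binder
  can be kinded; without it, an inner declaration would not shadow an outer one.
\<close>

definition fresh :: "tyvar \<Rightarrow> env \<Rightarrow> bool" where
  "fresh x \<Delta> \<longleftrightarrow> Var x \<notin> fst ` set \<Delta>"

inductive kinding :: "env \<Rightarrow> ty \<Rightarrow> kind \<Rightarrow> bool"  ("_ \<turnstile> _ \<Colon> _" [51, 51, 51] 50) where
  kind_var: "(Var x, K) \<in> set \<Delta> \<Longrightarrow> \<Delta> \<turnstile> TVar x \<Colon> Term K"
| kind_con: "(Con F, K) \<in> set \<Delta> \<Longrightarrow> \<Delta> \<turnstile> TCon F \<Colon> Term K"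
| kind_app: "\<Delta> \<turnstile> T1 \<Colon> Term Star \<Longrightarrow> \<Delta> \<turnstile> T2 \<Colon> Term (Arr K) \<Longrightarrow> \<Delta> \<turnstile> TApp T2 T1 \<Colon> Term K"
| kind_lam: "fresh x \<Delta> \<Longrightarrow> (Var x, Star) # \<Delta> \<turnstile> T \<Colon> Term K \<Longrightarrow> x \<in> FV T \<Longrightarrow>
    \<Delta> \<turnstile> TLam x T \<Colon> Term (Arr K)"
| kind_all: "fresh x \<Delta> \<Longrightarrow> (Var x, K) # \<Delta> \<turnstile> T \<Colon> k \<Longrightarrow> k \<in> {Prop, Term Star} \<Longrightarrow>
    \<Delta> \<turnstile> TAll x K T \<Colon> Prop"
| kind_imp: "\<Delta> \<turnstile> T \<Colon> k \<Longrightarrow> k \<in> {Prop, Term Star} \<Longrightarrow> \<Delta> \<turnstile> T' \<Colon> k' \<Longrightarrow> k' \<in> {Prop, Term Star} \<Longrightarrow>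
    \<Delta> \<turnstile> TImp T T' \<Colon> Prop"

inductive red_o :: "ty \<Rightarrow> ty \<Rightarrow> bool"  (infix "\<rightarrow>\<^sub>o" 50) where
  red_beta: "TApp (TLam x T) U \<rightarrow>\<^sub>o subst U x T"
| red_lam: "T \<rightarrow>\<^sub>o T' \<Longrightarrow> TLam x T \<rightarrow>\<^sub>o TLam x T'"
| red_all: "T \<rightarrow>\<^sub>o T' \<Longrightarrow> TAll x K T \<rightarrow>\<^sub>o TAll x K T'"
| red_app_fun: "T \<rightarrow>\<^sub>o T' \<Longrightarrow> TApp T U \<rightarrow>\<^sub>o TApp T' U"
| red_app_arg: "U \<rightarrow>\<^sub>o U' \<Longrightarrow> TApp T U \<rightarrow>\<^sub>o TApp T U'"
| red_imp_left: "T \<rightarrow>\<^sub>o T' \<Longrightarrow> TImp T U \<rightarrow>\<^sub>o TImp T' U"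
| red_imp_right: "U \<rightarrow>\<^sub>o U' \<Longrightarrow> TImp T U \<rightarrow>\<^sub>o TImp T U'"

end

(* The kinding and reduction rules are equivariant under injective renamings of type variables, so
   bound names can be swapped at will. This yields weakening and hence the substitution lemma, where
   no renaming is needed: the freshness side conditions of the rules already prevent capture, because
   a kinded type has its free variables declared. In a kinded redex the bound variable occurs in the
   body of the abstraction, so contracting the redex does not erase the argument. *)
theory Submission
  imports Defs "HOL-Combinatorics.Transposition"
begin

section \<open>Injectivity and disjointness of the type constructors\<close>

lemma ty_inject [simp]:
  "TCon F = TCon G \<longleftrightarrow> F = G"
  "TVar x = TVar y \<longleftrightarrow> x = y"
  "TApp T U = TApp T' U' \<longleftrightarrow> T = T' \<and> U = U'"
  "TImp T U = TImp T' U' \<longleftrightarrow> T = T' \<and> U = U'"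
  by (transfer; simp)+

lemma ty_distinct:
  "TCon F \<noteq> TApp T U" "TVar x \<noteq> TApp T U" "TLam x V \<noteq> TApp T U" "TAll x K V \<noteq> TApp T U"
  "TImp V W \<noteq> TApp T U"
  "TCon F \<noteq> TImp T U" "TVar x \<noteq> TImp T U" "TLam x V \<noteq> TImp T U" "TAll x K V \<noteq> TImp T U"
  "TCon F \<noteq> TLam y T" "TVar x \<noteq> TLam y T" "TAll x K V \<noteq> TLam y T"
  "TCon F \<noteq> TAll y L T" "TVar x \<noteq> TAll y L T"
  by (transfer; simp)+

lemmas [simp] = ty_distinct ty_distinct[symmetric]

section \<open>Renaming\<close>

primrec pre_ren :: "(tyvar \<Rightarrow> tyvar) \<Rightarrow> pre \<Rightarrow> pre" where
  "pre_ren f (PCon F) = PCon F"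
| "pre_ren f (PBound i) = PBound i"
| "pre_ren f (PFree x) = PFree (f x)"
| "pre_ren f (PLam t) = PLam (pre_ren f t)"
| "pre_ren f (PAll K t) = PAll K (pre_ren f t)"
| "pre_ren f (PApp t u) = PApp (pre_ren f t) (pre_ren f u)"
| "pre_ren f (PImp t u) = PImp (pre_ren f t) (pre_ren f u)"

lemma closed_at_pre_ren: "closed_at n (pre_ren f t) \<longleftrightarrow> closed_at n t"
  by (induction t arbitrary: n) auto

text \<open>Injectivity keeps any other free name from being sent to \<open>f x\<close> and captured
  by the binder.\<close>

lemma pre_ren_bind_at: "inj f \<Longrightarrow> pre_ren f (bind_at n x t) = bind_at n (f x) (pre_ren f t)"
  by (induction t arbitrary: n) (auto dest: injD)

lemma pre_ren_pre_subst:
  "inj f \<Longrightarrow> pre_ren f (pre_subst s x t) = pre_subst (pre_ren f s) (f x) (pre_ren f t)"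
  by (induction t) (auto dest: injD)

lemma pre_FV_pre_ren: "pre_FV (pre_ren f t) = f ` pre_FV t"
  by (induction t) auto

lemma pre_ren_comp: "pre_ren f (pre_ren g t) = pre_ren (f \<circ> g) t"
  by (induction t) auto

lemma pre_ren_ident: "pre_ren id t = t"
  by (induction t) auto

text \<open>A swap, unlike a substitution of names, is a bijection, so equivariance applies to it;
  when \<open>y\<close> does not occur, the two have the same effect.\<close>

lemma pre_ren_transpose:
  "y \<notin> pre_FV t \<Longrightarrow> pre_ren (transpose x y) t = pre_subst (PFree y) x t"
  by (induction t) (auto simp: transpose_def)

lemma pre_subst_pre_subst_PFree:
  "y \<notin> pre_FV t \<Longrightarrow> pre_subst s y (pre_subst (PFree y) x t) = pre_subst s x t"
  by (induction t) auto

text \<open>The case distinction records erasure: the variables of \<open>s\<close> survive only if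
  \<open>x\<close> occurs in \<open>t\<close>.\<close>

lemma pre_FV_pre_subst:
  "pre_FV (pre_subst s x t) = pre_FV t - {x} \<union> (if x \<in> pre_FV t then pre_FV s else {})"
  by (induction t) auto

lift_definition ren :: "(tyvar \<Rightarrow> tyvar) \<Rightarrow> ty \<Rightarrow> ty" is pre_ren
  by (simp add: closed_at_pre_ren)

lemma ren_simps [simp]:
  "ren f (TCon F) = TCon F"
  "ren f (TVar x) = TVar (f x)"
  "ren f (TApp T U) = TApp (ren f T) (ren f U)"
  "ren f (TImp T U) = TImp (ren f T) (ren f U)"
  "inj f \<Longrightarrow> ren f (TLam x T) = TLam (f x) (ren f T)"
  "inj f \<Longrightarrow> ren f (TAll x K T) = TAll (f x) K (ren f T)"
  by (transfer; simp add: pre_ren_bind_at)+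

lemma ren_subst: "inj f \<Longrightarrow> ren f (subst U x T) = subst (ren f U) (f x) (ren f T)"
  by transfer (rule pre_ren_pre_subst)

lemma FV_ren: "FV (ren f T) = f ` FV T"
  by transfer (rule pre_FV_pre_ren)

lemma ren_transpose_involutory: "ren (transpose x y) (ren (transpose x y) T) = T"
  by transfer (simp add: pre_ren_comp pre_ren_ident)

lemma ren_transpose: "y \<notin> FV T \<Longrightarrow> ren (transpose x y) T = subst (TVar y) x T"
  by transfer (rule pre_ren_transpose)

lemma subst_subst_TVar: "y \<notin> FV T \<Longrightarrow> subst U y (subst (TVar y) x T) = subst U x T"
  by transfer (rule pre_subst_pre_subst_PFree)

lemma FV_subst: "FV (subst U x T) = FV T - {x} \<union> (if x \<in> FV T then FV U else {})"
  by transfer (rule pre_FV_pre_subst)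

lemma ren_ident [simp]: "ren id T = T"
  by transfer (simp add: pre_ren_ident)

text \<open>Alpha-conversion as a swap. The side condition also admits \<open>y = x\<close>, where
  the swap is the identity.\<close>

lemma TLam_transpose: "y \<notin> FV T - {x} \<Longrightarrow> TLam x T = TLam y (ren (transpose x y) T)"
  by (cases "x = y") (auto simp: TLam_eq_iff ren_transpose)

lemma TAll_transpose: "y \<notin> FV T - {x} \<Longrightarrow> TAll x K T = TAll y K (ren (transpose x y) T)"
  by (cases "x = y") (auto simp: TAll_eq_iff ren_transpose)

text \<open>Compares two representatives of one abstraction. By the last claim the contractum of a
  redex does not depend on the representative.\<close>

lemma TLam_eqD:
  assumes "TLam x T = TLam y U"
  shows "y \<notin> FV T - {x}" "U = ren (transpose x y) T" "subst V x T = subst V y U"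
  using assms by (auto simp: TLam_eq_iff ren_transpose subst_subst_TVar)

lemma TAll_eqD:
  assumes "TAll x K T = TAll y L U"
  shows "K = L" "y \<notin> FV T - {x}" "U = ren (transpose x y) T"
  using assms by (auto simp: TAll_eq_iff ren_transpose)

section \<open>Fresh names and equivariance of kinding\<close>

lemma ex_fresh: "\<exists>y. fresh y \<Delta> \<and> y \<notin> FV T"
proof -
  \<comment> \<open>The preimage under the injective constructor \<open>Var\<close> collects the
    declared variables.\<close>
  have "finite (FV T \<union> Var -` (fst ` set \<Delta>))"
    by (intro finite_UnI finite_FV finite_vimageI) (auto simp: inj_def)
  then obtain y :: tyvar where "y \<notin> FV T \<union> Var -` (fst ` set \<Delta>)"
    by (metis ex_new_if_finite infinite_UNIV_listI)
  then show ?thesis by (auto simp: fresh_def)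
qed

fun name_ren :: "(tyvar \<Rightarrow> tyvar) \<Rightarrow> name \<Rightarrow> name" where
  "name_ren f (Var x) = Var (f x)"
| "name_ren f (Con F) = Con F"

definition env_ren :: "(tyvar \<Rightarrow> tyvar) \<Rightarrow> env \<Rightarrow> env" where
  "env_ren f = map (\<lambda>(a, K). (name_ren f a, K))"

lemma env_ren_Cons [simp]: "env_ren f ((Var x, K) # \<Delta>) = (Var (f x), K) # env_ren f \<Delta>"
  by (simp add: env_ren_def)

lemma env_renI:
  "(Var x, K) \<in> set \<Delta> \<Longrightarrow> (Var (f x), K) \<in> set (env_ren f \<Delta>)"
  "(Con F, K) \<in> set \<Delta> \<Longrightarrow> (Con F, K) \<in> set (env_ren f \<Delta>)"
  by (force simp: env_ren_def)+

lemma fresh_env_ren: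
  assumes "inj f"
  shows "fresh (f x) (env_ren f \<Delta>) \<longleftrightarrow> fresh x \<Delta>"
proof -
  have "Var (f x) = name_ren f a \<longleftrightarrow> a = Var x" for a
    using assms by (cases a) (auto dest: injD)
  moreover have "fst ` set (env_ren f \<Delta>) = name_ren f ` fst ` set \<Delta>"
    by (force simp: env_ren_def)
  ultimately show ?thesis by (auto simp: fresh_def image_iff)
qed

lemma env_ren_transpose_involutory:
  "env_ren (transpose x y) (env_ren (transpose x y) \<Delta>) = \<Delta>"
proof -
  have "name_ren (transpose x y) (name_ren (transpose x y) a) = a" for a
    by (cases a) auto
  then show ?thesis by (simp add: env_ren_def comp_def case_prod_beta)
qed

lemma env_ren_transpose_fresh:
  assumes "fresh x \<Delta>" "fresh y \<Delta>"
  shows "env_ren (transpose x y) \<Delta> = \<Delta>"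
proof -
  have "name_ren (transpose x y) a = a" if "(a, K) \<in> set \<Delta>" for a K
    using that assms by (cases a) (force simp: fresh_def transpose_def)+
  then show ?thesis by (auto simp: env_ren_def intro!: map_idI)
qed

text \<open>Each rule is stable under renaming; injectivity keeps the image of a bound name fresh in
  the renamed environment.\<close>

lemma kinding_ren:
  "\<Delta> \<turnstile> T \<Colon> k \<Longrightarrow> inj f \<Longrightarrow> env_ren f \<Delta> \<turnstile> ren f T \<Colon> k"
proof (induction rule: kinding.induct)
  case (kind_app \<Delta> T1 T2 K)
  then show ?case by (auto intro: kinding.kind_app)
next
  case (kind_lam x \<Delta> T K)
  then show ?case by (auto intro!: kinding.kind_lam simp: fresh_env_ren FV_ren)
next
  case (kind_all x \<Delta> K T k)
  then show ?case by (auto intro!: kinding.kind_all[where k = k] simp: fresh_env_ren)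
next
  case (kind_imp \<Delta> T k T' k')
  then show ?case by (auto intro: kinding.kind_imp)
qed (auto intro: kinding.kind_var kinding.kind_con env_renI)

text \<open>Moves a swap from the type to the environment, so that an induction hypothesis about
  \<open>T\<close> itself can be used after the bound name is changed. Both directions are
  equivariance, as a swap is its own inverse.\<close>

lemma kinding_transpose_iff:
  "(Var y, K) # \<Delta> \<turnstile> ren (transpose x y) T \<Colon> k \<longleftrightarrow>
    (Var x, K) # env_ren (transpose x y) \<Delta> \<turnstile> T \<Colon> k"
proof
  assume "(Var y, K) # \<Delta> \<turnstile> ren (transpose x y) T \<Colon> k"
  from kinding_ren[OF this, of "transpose x y"]
  show "(Var x, K) # env_ren (transpose x y) \<Delta> \<turnstile> T \<Colon> k"
    by (simp add: ren_transpose_involutory)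
next
  assume "(Var x, K) # env_ren (transpose x y) \<Delta> \<turnstile> T \<Colon> k"
  from kinding_ren[OF this, of "transpose x y"]
  show "(Var y, K) # \<Delta> \<turnstile> ren (transpose x y) T \<Colon> k"
    by (simp add: env_ren_transpose_involutory)
qed

section \<open>Weakening and substitution\<close>

lemma kinding_FV: "\<Delta> \<turnstile> T \<Colon> k \<Longrightarrow> x \<in> FV T \<Longrightarrow> \<not> fresh x \<Delta>"
  by (induction rule: kinding.induct) (force simp: fresh_def)+

text \<open>Provides the inclusion needed under a binder in weakening: \<open>\<Delta>'\<close> may
  declare \<open>x\<close>, but the swap fixes \<open>\<Delta>\<close>, where both names are
  fresh.\<close>

lemma env_ren_transpose_weaken:
  assumes "fresh x \<Delta>" "set \<Delta> \<subseteq> set \<Delta>'" "fresh y \<Delta>'"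
  shows "set ((Var x, K) # \<Delta>) \<subseteq> set ((Var x, K) # env_ren (transpose x y) \<Delta>')"
proof -
  have "fresh y \<Delta>" using assms(2,3) by (auto simp: fresh_def)
  then have "set \<Delta> = set (env_ren (transpose x y) \<Delta>)"
    using assms(1) by (simp add: env_ren_transpose_fresh)
  also have "\<dots> \<subseteq> set (env_ren (transpose x y) \<Delta>')"
    using assms(2) by (auto simp: env_ren_def)
  finally show ?thesis by auto
qed

text \<open>The larger environment may declare a bound name, which is then exchanged for a fresh
  \<open>y\<close>. Comparing sets of declarations makes exchange a special case.\<close>

lemma kinding_weaken: "\<Delta> \<turnstile> T \<Colon> k \<Longrightarrow> set \<Delta> \<subseteq> set \<Delta>' \<Longrightarrow> \<Delta>' \<turnstile> T \<Colon> k"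
proof (induction arbitrary: \<Delta>' rule: kinding.induct)
  case (kind_lam x \<Delta> T K)
  obtain y where y: "fresh y \<Delta>'" "y \<notin> FV T" using ex_fresh by blast
  have "(Var y, Star) # \<Delta>' \<turnstile> ren (transpose x y) T \<Colon> Term K"
    unfolding kinding_transpose_iff
    using kind_lam.hyps(1) kind_lam.prems y(1) by (intro kind_lam.IH env_ren_transpose_weaken)
  moreover have "y \<in> FV (ren (transpose x y) T)"
    using kind_lam.hyps by (force simp: FV_ren)
  ultimately show ?case
    using y by (simp add: TLam_transpose[of y T x] kinding.kind_lam)
next
  case (kind_all x \<Delta> K T k)
  obtain y where y: "fresh y \<Delta>'" "y \<notin> FV T" using ex_fresh by blast
  have "(Var y, K) # \<Delta>' \<turnstile> ren (transpose x y) T \<Colon> k"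
    unfolding kinding_transpose_iff
    using kind_all.hyps(1) kind_all.prems y(1) by (intro kind_all.IH env_ren_transpose_weaken)
  then show ?case
    using y kind_all.hyps by (simp add: TAll_transpose[of y T x] kinding.kind_all)
next
  case (kind_app \<Delta> T1 T2 K)
  then show ?case by (auto intro: kinding.kind_app)
next
  case (kind_imp \<Delta> T k T' k')
  then show ?case by (auto intro: kinding.kind_imp)
qed (auto intro: kinding.kind_var kinding.kind_con)

text \<open>Describing \<open>\<Gamma>\<close> by its set leaves the position of \<open>y\<close>
  open, so the induction hypothesis still applies after a binder puts its own declaration in
  front.\<close>

lemma kinding_subst:
  assumes "\<Gamma> \<turnstile> T \<Colon> k" "set \<Gamma> = insert (Var y, Star) (set \<Delta>)" "fresh y \<Delta>" "\<Delta> \<turnstile> U \<Colon> Term Star"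
  shows "\<Delta> \<turnstile> subst U y T \<Colon> k"
  using assms
proof (induction arbitrary: \<Delta> rule: kinding.induct)
  case (kind_var x K \<Gamma>)
  then show ?case by (force simp: subst_simps fresh_def intro: kinding.kind_var)
next
  case (kind_con F K \<Gamma>)
  then show ?case by (auto simp: subst_simps intro: kinding.kind_con)
next
  case (kind_app \<Gamma> T1 T2 K)
  then show ?case by (auto simp: subst_simps intro: kinding.kind_app)
next
  case (kind_lam x \<Gamma> T K)
  then have x: "fresh x \<Delta>" "x \<noteq> y" by (auto simp: fresh_def)
  \<comment> \<open>\<open>U\<close> is kinded in \<open>\<Delta>\<close>, where \<open>x\<close> is
    undeclared, so substitution passes under the binder without capture.\<close>
  with kind_lam.prems have xU: "x \<notin> FV U" using kinding_FV by blast
  have "(Var x, Star) # \<Delta> \<turnstile> subst U y T \<Colon> Term K"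
    using kind_lam.prems x by (intro kind_lam.IH) (auto simp: fresh_def intro: kinding_weaken)
  then show ?case
    using x xU kind_lam.hyps by (auto simp: subst_simps FV_subst intro: kinding.kind_lam)
next
  case (kind_all x \<Gamma> K T k)
  then have x: "fresh x \<Delta>" "x \<noteq> y" by (auto simp: fresh_def)
  with kind_all.prems have xU: "x \<notin> FV U" using kinding_FV by blast
  have "(Var x, K) # \<Delta> \<turnstile> subst U y T \<Colon> k"
    using kind_all.prems x by (intro kind_all.IH) (auto simp: fresh_def intro: kinding_weaken)
  then show ?case
    using x xU kind_all.hyps by (auto simp: subst_simps intro: kinding.kind_all)
next
  case (kind_imp \<Gamma> T k T' k')
  then show ?case by (auto simp: subst_simps intro: kinding.kind_imp)
qed

section \<open>Subject reduction\<close>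

inductive_cases kinding_TAppE: "\<Delta> \<turnstile> TApp T U \<Colon> k"
inductive_cases kinding_TLamE: "\<Delta> \<turnstile> TLam x T \<Colon> k"
inductive_cases kinding_TAllE: "\<Delta> \<turnstile> TAll x K T \<Colon> k"
inductive_cases kinding_TImpE: "\<Delta> \<turnstile> TImp T U \<Colon> k"

theorem theorem7:
  fixes \<Delta> :: env and T T' :: ty and k :: kind
  assumes "\<Delta> \<turnstile> T \<Colon> k"
    and "T \<rightarrow>\<^sub>o T'"
  shows "FV T = FV T' \<and> \<Delta> \<turnstile> T' \<Colon> k"
  using assms(2,1)
\<comment> \<open>Environment and kind are generalized: binders extend the former, and the function
  part of an application has a different kind.\<close>
proof (induction arbitrary: \<Delta> k rule: red_o.induct)
  case (red_beta x T U)
  then obtain K where U: "\<Delta> \<turnstile> U \<Colon> Term Star" and k: "k = Term K"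
    and lam: "\<Delta> \<turnstile> TLam x T \<Colon> Term (Arr K)"
    by (blast elim: kinding_TAppE)
  \<comment> \<open>Inversion yields some representative of the abstraction, with a bound name
    \<open>y\<close> that may differ from \<open>x\<close>.\<close>
  from lam obtain y V where eq: "TLam x T = TLam y V" and y: "fresh y \<Delta>" "y \<in> FV V"
    and V: "(Var y, Star) # \<Delta> \<turnstile> V \<Colon> Term K"
    by (blast elim: kinding_TLamE)
  have "\<Delta> \<turnstile> subst U y V \<Colon> Term K" using kinding_subst[OF V _ y(1) U] by simp
  \<comment> \<open>Since \<open>y\<close> occurs in \<open>V\<close>, both redex and contractum
    have the free variables \<open>FV V - {y} \<union> FV U\<close>.\<close>
  moreover have "FV (TLam x T) = FV V - {y}" by (simp only: eq FV_simps)
  ultimately show ?case using TLam_eqD(3)[OF eq, of U] y k by (simp add: FV_subst)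
next
  case (red_lam T T' x)
  from red_lam.prems obtain y V K where eq: "TLam x T = TLam y V" and y: "fresh y \<Delta>" "y \<in> FV V"
    and k: "k = Term (Arr K)" and V: "(Var y, Star) # \<Delta> \<turnstile> V \<Colon> Term K"
    by (blast elim: kinding_TLamE)
  note eqD = TLam_eqD[OF eq]
  \<comment> \<open>\<open>V\<close> is \<open>T\<close> with \<open>x\<close> and \<open>y\<close>
    swapped; undoing the swap in the environment gives a kinding of \<open>T\<close>.\<close>
  have IH: "FV T = FV T'" "(Var x, Star) # env_ren (transpose x y) \<Delta> \<turnstile> T' \<Colon> Term K"
    using red_lam.IH V unfolding eqD(2) kinding_transpose_iff by blast+
  \<comment> \<open>The occurrence condition on \<open>y\<close> carries over from \<open>T\<close>
    to \<open>T'\<close> by \<open>FV T = FV T'\<close>, which is why both claims are proved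
    together.\<close>
  have "\<Delta> \<turnstile> TLam y (ren (transpose x y) T') \<Colon> k"
    unfolding k using IH y eqD(2) by (intro kind_lam) (simp_all add: kinding_transpose_iff FV_ren)
  \<comment> \<open>\<open>y\<close> is also not in \<open>FV T' - {x}\<close>, so the bound name
    can be changed back to \<open>x\<close>.\<close>
  then show ?case using IH(1) eqD(1) by (simp flip: TLam_transpose)
next
  case (red_all T T' x K)
  from red_all.prems obtain y V k' where eq: "TAll x K T = TAll y K V" and y: "fresh y \<Delta>"
    and k: "k = Prop" "k' \<in> {Prop, Term Star}" and V: "(Var y, K) # \<Delta> \<turnstile> V \<Colon> k'"
    \<comment> \<open>Equality of quantified types includes their kind annotations, so the inverted
      one is again \<open>K\<close>.\<close>
    by (elim kinding_TAllE) (auto dest: TAll_eqD(1))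
  note eqD = TAll_eqD[OF eq]
  have IH: "FV T = FV T'" "(Var x, K) # env_ren (transpose x y) \<Delta> \<turnstile> T' \<Colon> k'"
    using red_all.IH V unfolding eqD(3) kinding_transpose_iff by blast+
  have "\<Delta> \<turnstile> TAll y K (ren (transpose x y) T') \<Colon> k"
    unfolding k(1) using IH y k(2) by (intro kind_all) (simp_all add: kinding_transpose_iff)
  then show ?case using IH(1) eqD(2) by (simp flip: TAll_transpose)
next
  case (red_app_fun T T' U)
  from red_app_fun.prems red_app_fun.IH show ?case
    by (elim kinding_TAppE) (simp, blast intro: kind_app)
next
  case (red_app_arg U U' T)
  from red_app_arg.prems red_app_arg.IH show ?case
    by (elim kinding_TAppE) (simp, blast intro: kind_app)
next
  case (red_imp_left T T' U)
  from red_imp_left.prems red_imp_left.IH show ?case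
    by (elim kinding_TImpE) (simp, blast intro: kind_imp)
next
  case (red_imp_right U U' T)
  from red_imp_right.prems red_imp_right.IH show ?case
    by (elim kinding_TImpE) (simp, blast intro: kind_imp)
qed

end
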